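(* Let $p_0\in\mathbb{R}^d$. A compact subset $K\subset\mathbb{R}^d$ containing all balls $\mathbb{B}_{p_0,p}$ with diameters $p_0p$ for arbitrary $p\in K$ is a ball centered at $p_0$.
   Context: For $p_0,p\in\mathbb{R}^d$ (Euclidean space), $\mathbb{B}_{p_0,p}$ denotes the ball with the segment $p_0p$ as a diameter, i.e. the ball centered at $\frac{p_0+p}{2}$ with radius $\frac{|p-p_0|}{2}$.
   Formalization: The formal statement assumes d ≥ 2 and K nonempty; for d = 1 the claim fails (p_0 = 0, K = [-1,2] contains every segment from 0 to p in K but is not a ball centered at 0), and the empty set is not a ball. *)

theory Defs
  imports "HOL-Analysis.Analysis"
begin

text \<open>Balls are closed, and a single point counts as a ball of radius 0
  (the case \<open>p = p0\<close>).\<close>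

definition diameter_ball :: "real ^ 'n \<Rightarrow> real ^ 'n \<Rightarrow> (real ^ 'n) set" where
  "diameter_ball p0 p = cball (midpoint p0 p) (norm (p - p0) / 2)"

end

theory Submission
  imports Defs "HOL-Real_Asymp.Real_Asymp"
begin

text \<open>
  By Thales, \<open>p0 + x\<close> lies in the ball with diameter \<open>p0 p\<close> iff \<open>x \<bullet> x \<le> x \<bullet> (p - p0)\<close>. So from a point of
  \<open>K\<close> at distance \<open>s\<close> from \<open>p0\<close> one reaches, turning by an angle \<open>b\<close> in any plane, a point of \<open>K\<close> at
  distance \<open>s cos b\<close>. Turning \<open>n\<close> times by \<open>\<theta>/n\<close> costs only the factor \<open>cos (\<theta>/n) ^ n\<close>, which tends
  to \<open>1\<close>; as \<open>K\<close> is closed, the whole sphere through a farthest point of \<open>K\<close> lies in \<open>K\<close>, and the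
  segments from \<open>p0\<close> to this sphere fill the ball.
\<close>

lemma diameter_ball_iff:
  "p0 + x \<in> diameter_ball p0 p \<longleftrightarrow> x \<bullet> x \<le> x \<bullet> (p - p0)"
proof -
  define q where "q = p - p0"
  have p: "p = p0 + q" by (simp add: q_def)
  have "midpoint p0 p = p0 + q /\<^sub>R 2"
    unfolding midpoint_def p by (simp add: vec_eq_iff algebra_simps)
  hence "dist (midpoint p0 p) (p0 + x) = norm (x - q /\<^sub>R 2)"
    by (simp add: dist_norm norm_minus_commute)
  hence "p0 + x \<in> diameter_ball p0 p \<longleftrightarrow> norm (x - q /\<^sub>R 2) \<le> norm (q /\<^sub>R 2)"
    by (simp add: diameter_ball_def q_def)
  \<comment> \<open>After squaring, the term \<open>(q \<bullet> q) / 4\<close> cancels on both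
    sides.\<close>
  also have "\<dots> \<longleftrightarrow> x \<bullet> x \<le> x \<bullet> q"
    unfolding norm_le by (simp add: inner_diff_left inner_diff_right inner_commute)
  finally show ?thesis by (simp add: q_def)
qed

text \<open>The logarithm \<open>n * ln (cos (\<theta> / n))\<close> behaves like
  \<open>-\<theta>^2 / (2 * n)\<close>, hence tends to 0.\<close>

lemma cos_divide_power_tendsto_1:
  "(\<lambda>n. cos (\<theta> / real n) ^ n) \<longlonglongrightarrow> 1"
  by real_asymp

lemma rotated_mem:
  fixes p0 :: "real ^ 'n" and K :: "(real ^ 'n) set"
  assumes "closed K"
    and K: "\<And>p. p \<in> K \<Longrightarrow> diameter_ball p0 p \<subseteq> K"
    and u: "norm u = 1" and w: "norm w = 1" and uw: "u \<bullet> w = 0"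
    and start: "p0 + s *\<^sub>R u \<in> K"
  shows "p0 + s *\<^sub>R (cos \<theta> *\<^sub>R u + sin \<theta> *\<^sub>R w) \<in> K"
proof -
  define \<gamma> where "\<gamma> = (\<lambda>t. cos t *\<^sub>R u + sin t *\<^sub>R w)"
  have uu: "u \<bullet> u = 1" and ww: "w \<bullet> w = 1" and wu: "w \<bullet> u = 0"
    using u w uw by (simp_all add: norm_eq_1 inner_commute)
  have inner: "\<gamma> a \<bullet> \<gamma> b = cos (a - b)" for a b
    by (simp add: \<gamma>_def inner_add_left inner_add_right uu ww uw wu cos_diff)
  have steps: "p0 + (s * cos b ^ n) *\<^sub>R \<gamma> (real n * b) \<in> K" for b n
  proof (induction n)
    case 0
    show ?case using start by (simp add: \<gamma>_def)
  next
    case (Suc n)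
    \<comment> \<open>The criterion holds with equality: both inner products are
      \<open>s^2 * cos b ^ (2 * n + 2)\<close>, so the new point lies on the bounding
      sphere.\<close>
    have "p0 + (s * cos b ^ Suc n) *\<^sub>R \<gamma> (real (Suc n) * b)
        \<in> diameter_ball p0 (p0 + (s * cos b ^ n) *\<^sub>R \<gamma> (real n * b))"
      unfolding diameter_ball_iff by (simp add: inner algebra_simps)
    thus ?case using K[OF Suc] by blast
  qed
  have "(\<lambda>n. p0 + (s * cos (\<theta> / real n) ^ n) *\<^sub>R \<gamma> \<theta>) \<longlonglongrightarrow> p0 + (s * 1) *\<^sub>R \<gamma> \<theta>"
    by (intro tendsto_intros cos_divide_power_tendsto_1)
  moreover have "eventually (\<lambda>n. p0 + (s * cos (\<theta> / real n) ^ n) *\<^sub>R \<gamma> \<theta> \<in> K) sequentially"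
    \<comment> \<open>For \<open>n > 0\<close> the total angle \<open>n * (\<theta> / n)\<close> is
      \<open>\<theta>\<close>; at \<open>n = 0\<close> it would be 0.\<close>
    using eventually_gt_at_top[of 0]
  proof eventually_elim
    case (elim n)
    thus ?case using steps[of "\<theta> / real n" n] by simp
  qed
  ultimately have "p0 + (s * 1) *\<^sub>R \<gamma> \<theta> \<in> K"
    by (rule Lim_in_closed_set[OF \<open>closed K\<close>, rotated 2]) simp
  thus ?thesis by (simp add: \<gamma>_def)
qed

text \<open>Normalising the component of \<open>v\<close> orthogonal to \<open>u\<close> gives
  \<open>w\<close>. If \<open>v\<close> is \<open>u\<close> or \<open>-u\<close>, this component
  vanishes and any unit vector orthogonal to \<open>u\<close> serves; dimension at least 2 provides
  one.\<close>

lemma unit_vector_polar: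
  fixes u v :: "'a :: euclidean_space"
  assumes "DIM('a) \<ge> 2" and u: "norm u = 1" and v: "norm v = 1"
  obtains w \<theta> where "norm w = 1" "u \<bullet> w = 0" "v = cos \<theta> *\<^sub>R u + sin \<theta> *\<^sub>R w"
proof -
  define z where "z = v - (v \<bullet> u) *\<^sub>R u"
  have uu: "u \<bullet> u = 1" and vv: "v \<bullet> v = 1"
    using u v by (simp_all add: norm_eq_1)
  have uz: "u \<bullet> z = 0"
    by (simp add: z_def inner_diff_right uu inner_commute)
  obtain w where w: "norm w = 1" "u \<bullet> w = 0" "z = norm z *\<^sub>R w"
  proof (cases "z = 0")
    case True
    obtain y where "y \<noteq> 0" "orthogonal u y"
      using orthogonal_to_vector_exists assms(1) by blast
    thus ?thesis
      using True by (intro that[of "sgn y"]) (auto simp: norm_sgn sgn_div_norm orthogonal_def)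
  next
    case False
    thus ?thesis
      using uz by (intro that[of "sgn z"]) (auto simp: norm_sgn sgn_div_norm)
  qed
  have "(norm z)\<^sup>2 = 1 - (v \<bullet> u)\<^sup>2"
    unfolding power2_norm_eq_inner
    by (simp add: z_def inner_diff_left inner_diff_right uu vv inner_commute power2_eq_square)
  hence "(v \<bullet> u)\<^sup>2 + (norm z)\<^sup>2 = 1" by simp
  then obtain \<theta> where \<theta>: "v \<bullet> u = cos \<theta>" "norm z = sin \<theta>"
    using sincos_total_2pi by metis
  have "v = (v \<bullet> u) *\<^sub>R u + norm z *\<^sub>R w"
    using w(3) by (simp add: z_def flip: w(3))
  thus ?thesis using that w \<theta> by metis
qed

theorem proposition1p2:
  fixes p0 :: "real ^ 'n" and K :: "(real ^ 'n) set"
  assumes "CARD('n) \<ge> 2"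
    and "compact K"
    and "K \<noteq> {}"
    and "\<And>p. p \<in> K \<Longrightarrow> diameter_ball p0 p \<subseteq> K"
  shows "\<exists>r\<ge>0. K = cball p0 r"
proof -
  obtain p where p: "p \<in> K" and far: "\<And>q. q \<in> K \<Longrightarrow> dist p0 q \<le> dist p0 p"
    using distance_attains_sup[OF assms(2,3)] by blast
  define r where "r = norm (p - p0)"
  have "cball p0 r \<subseteq> K"
  proof
    fix y assume y: "y \<in> cball p0 r"
    show "y \<in> K"
    proof (cases "y = p0")
      case True
      have "p0 + 0 \<in> diameter_ball p0 p" unfolding diameter_ball_iff by simp
      thus ?thesis using assms(4)[OF p] True by auto
    next
      case False
      define v where "v = sgn (y - p0)"
      have yv: "y = p0 + norm (y - p0) *\<^sub>R v"
        using False by (simp add: v_def sgn_div_norm)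
      have le: "norm (y - p0) \<le> r"
        using y by (simp add: dist_norm norm_minus_commute)
      hence "r > 0" using False by (smt (verit) zero_less_norm_iff right_minus_eq)
      hence "p \<noteq> p0" by (auto simp: r_def)
      have "norm v = 1" "norm (sgn (p - p0)) = 1"
        using False \<open>p \<noteq> p0\<close> by (simp_all add: v_def norm_sgn)
      \<comment> \<open>Dimension at least 2 enters here: on a line, every compact interval
        containing \<open>p0\<close> satisfies the condition on \<open>K\<close>.\<close>
      then obtain w \<theta> where "norm w = 1" "sgn (p - p0) \<bullet> w = 0"
        "v = cos \<theta> *\<^sub>R sgn (p - p0) + sin \<theta> *\<^sub>R w"
        using unit_vector_polar[of "sgn (p - p0)" v] assms(1) by auto
      moreover have "p0 + r *\<^sub>R sgn (p - p0) \<in> K"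
        using p \<open>p \<noteq> p0\<close> by (simp add: r_def sgn_div_norm)
      ultimately have "p0 + r *\<^sub>R v \<in> K"
        using rotated_mem[OF compact_imp_closed[OF assms(2)] assms(4)]
          \<open>norm (sgn (p - p0)) = 1\<close> by metis
      \<comment> \<open>\<open>y\<close> lies on the diameter itself: with
        \<open>t = norm (y - p0)\<close> the criterion reads
        \<open>t * t \<le> t * r\<close>.\<close>
      moreover have "y \<in> diameter_ball p0 (p0 + r *\<^sub>R v)"
        using le \<open>norm v = 1\<close>
        by (subst yv) (simp add: diameter_ball_iff norm_eq_1 mult_right_mono)
      ultimately show ?thesis using assms(4) by blast
    qed
  qed
  moreover have "K \<subseteq> cball p0 r"
    using far by (auto simp: r_def dist_norm norm_minus_commute)
  ultimately show ?thesis by (intro exI[of _ r]) (auto simp: r_def)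
qed

end
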